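(* Let $\mathcal{C}\subseteq X$ be a transversal for $\sim$ (a set containing exactly one element of each $\sim$-class), and for $0\le k\le h_{\mathcal K}$ let $\mathcal{C}(k)=\mathrm{v}(k)\cap \mathcal{C}$. Then (i) $\mathrm{St}(\mathcal K)=(\cdots(\mathrm{St}_0^{\mathrm v}\ltimes \mathrm{St}_1^{\mathrm v})\ltimes\cdots\ltimes \mathrm{St}_{h_{\mathcal K}-1}^{\mathrm v})\ltimes \mathrm{St}_{h_{\mathcal K}}^{\mathrm v}$, and (ii) $\mathrm{St}_k^{\mathrm v}=\prod_{y\in \mathcal{C}(k)}\mathrm{St}_y^{\mathrm v}$ for $k=0,\ldots,h_{\mathcal K}$.
   Context: Let $\Gamma$ be a finite simple graph with vertex set $X$, and let $\mathbb G=\mathbb G_\Gamma$ be the partially commutative group (right-angled Artin group) generated by $X$ with relations $[x,y]=1$ for each edge $\{x,y\}$ of $\Gamma$. For $Y\subseteq X$, $\mathbb G(Y)$ is the subgroup generated by $Y$. Automorphisms act on the right. For $x\in X$: $\mathrm{lk}(x)$ is the set of vertices adjacent to $x$, $\mathrm{st}(x)=\mathrm{lk}(x)\cup\{x\}$. Write $x\sim y$ if $\mathrm{st}(x)=\mathrm{st}(y)$ or $\mathrm{lk}(x)=\mathrm{lk}(y)$; this is an equivalence relation with classes $[x]$. The admissible set of $x$ is $\mathfrak a(x)=\bigcap_{y\in \mathrm{lk}(x)}\mathrm{st}(y)$ (equal to $X$ if $\mathrm{lk}(x)=\emptyset$), and $\mathcal K=\{\mathfrak a(x): x\in X\}$.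 Define $\mathrm{St}(\mathcal K)=\{\phi\in\mathrm{Aut}(\mathbb G): \mathbb G(Y)\phi=\mathbb G(Y)\text{ for all }Y\in\mathcal K\}$. The height $h(x)$ of $x\in X$ is the largest integer $i$ such that there is a strictly descending chain $\mathfrak a(x_i)\supsetneq \mathfrak a(x_{i-1})\supsetneq\cdots\supsetneq \mathfrak a(x_0)$ with $x_i=x$; $h_{\mathcal K}$ is the maximum of the heights of elements of $X$; $\mathrm v(k)=\{y\in X: h(y)=k\}$. Put $\mathrm{St}_k^{\mathrm v}=\{\phi\in \mathrm{St}(\mathcal K): y\phi=y\ \forall y\in X\setminus \mathrm v(k)\}$ and $\mathrm{St}_x^{\mathrm v}=\{\phi\in \mathrm{St}(\mathcal K): y\phi=y\ \forall y\in X\setminus [x]\}$. In $H\ltimes N$ the (internal) normal factor is $N$, written on the right; $\prod$ denotes internal direct product of subgroups. *)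

theory Defs
  imports "HOL-Algebra.Bij" "HOL-Algebra.Generated_Groups"
begin

section \<open>Finite simple graphs\<close>

definition finite_simple_graph :: "'v set \<Rightarrow> 'v set set \<Rightarrow> bool" where
  "finite_simple_graph X E \<longleftrightarrow> finite X \<and> (\<forall>e\<in>E. e \<subseteq> X \<and> card e = 2)"

definition lk :: "'v set set \<Rightarrow> 'v \<Rightarrow> 'v set" where
  "lk E x = {y. {x, y} \<in> E}"

definition st :: "'v set set \<Rightarrow> 'v \<Rightarrow> 'v set" where
  "st E x = lk E x \<union> {x}"

definition sim :: "'v set \<Rightarrow> 'v set set \<Rightarrow> ('v \<times> 'v) set" where
  "sim X E = {(x, y). x \<in> X \<and> y \<in> X \<and> (st E x = st E y \<or> lk E x = lk E y)}"

text \<open>Intersecting with \<open>X\<close> matters only if \<open>lk E x\<close> is empty; it then makes the value \<open>X\<close>.\<close>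

definition adm :: "'v set \<Rightarrow> 'v set set \<Rightarrow> 'v \<Rightarrow> 'v set" where
  "adm X E x = X \<inter> (\<Inter>y\<in>lk E x. st E y)"

definition admissible_sets :: "'v set \<Rightarrow> 'v set set \<Rightarrow> 'v set set" where
  "admissible_sets X E = adm X E ` X"

definition height :: "'v set \<Rightarrow> 'v set set \<Rightarrow> 'v \<Rightarrow> nat" where
  "height X E x = (GREATEST i. \<exists>c :: nat \<Rightarrow> 'v. c i = x \<and> (\<forall>j\<le>i. c j \<in> X) \<and>
     (\<forall>j<i. adm X E (c j) \<subset> adm X E (c (Suc j))))"

definition max_height :: "'v set \<Rightarrow> 'v set set \<Rightarrow> nat" where
  "max_height X E = Max (height X E ` X)"

definition level :: "'v set \<Rightarrow> 'v set set \<Rightarrow> nat \<Rightarrow> 'v set" where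
  "level X E k = {y \<in> X. height X E y = k}"

definition transversal :: "'v set \<Rightarrow> 'v set set \<Rightarrow> 'v set \<Rightarrow> bool" where
  "transversal X E C \<longleftrightarrow> C \<subseteq> X \<and> (\<forall>A \<in> X // sim X E. \<exists>!c. c \<in> A \<inter> C)"


section \<open>The partially commutative group of a graph\<close>

text \<open>
  A letter is a pair \<open>(x, b)\<close>: it stands for the generator \<open>x\<close> if \<open>b\<close> is true and for its inverse
  otherwise. The group consists of words over these letters modulo the least congruence
  containing \<open>x x\<inverse> = 1 = x\<inverse> x\<close> for all vertices \<open>x\<close> and \<open>x y = y x\<close> for all edges \<open>{x, y}\<close>.
\<close>

definition raag_words :: "'v set \<Rightarrow> ('v \<times> bool) list set" where
  "raag_words X = lists (X \<times> UNIV)"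

inductive_set raag_rel :: "'v set \<Rightarrow> 'v set set \<Rightarrow> (('v \<times> bool) list \<times> ('v \<times> bool) list) set"
  for X :: "'v set" and E :: "'v set set" where
  refl: "w \<in> raag_words X \<Longrightarrow> (w, w) \<in> raag_rel X E"
| sym: "(u, v) \<in> raag_rel X E \<Longrightarrow> (v, u) \<in> raag_rel X E"
| trans: "(u, v) \<in> raag_rel X E \<Longrightarrow> (v, w) \<in> raag_rel X E \<Longrightarrow> (u, w) \<in> raag_rel X E"
| append: "(u, u') \<in> raag_rel X E \<Longrightarrow> (v, v') \<in> raag_rel X E \<Longrightarrow> (u @ v, u' @ v') \<in> raag_rel X E"
| cancel: "x \<in> X \<Longrightarrow> ([(x, b), (x, \<not> b)], []) \<in> raag_rel X E"
| commute: "x \<in> X \<Longrightarrow> y \<in> X \<Longrightarrow> {x, y} \<in> E \<Longrightarrow>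
    ([(x, True), (y, True)], [(y, True), (x, True)]) \<in> raag_rel X E"

definition raag :: "'v set \<Rightarrow> 'v set set \<Rightarrow> ('v \<times> bool) list set monoid" where
  "raag X E =
    \<lparr>carrier = raag_words X // raag_rel X E,
     mult = \<lambda>A B. \<Union>u\<in>A. \<Union>v\<in>B. raag_rel X E `` {u @ v},
     one = raag_rel X E `` {[]}\<rparr>"

definition gen :: "'v set \<Rightarrow> 'v set set \<Rightarrow> 'v \<Rightarrow> ('v \<times> bool) list set" where
  "gen X E x = raag_rel X E `` {[(x, True)]}"

definition raag_on :: "'v set \<Rightarrow> 'v set set \<Rightarrow> 'v set \<Rightarrow> ('v \<times> bool) list set set" where
  "raag_on X E Y = generate (raag X E) (gen X E ` Y)"


section \<open>Internal products\<close>

text \<open>\<open>K = H \<ltimes> N\<close> inside \<open>G\<close>, with \<open>N\<close> the normal factor.\<close>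

definition internal_semidirect ::
    "('g, 'm) monoid_scheme \<Rightarrow> 'g set \<Rightarrow> 'g set \<Rightarrow> 'g set \<Rightarrow> bool" where
  "internal_semidirect G K H N \<longleftrightarrow>
     subgroup K G \<and> subgroup H (G\<lparr>carrier := K\<rparr>) \<and> N \<lhd> (G\<lparr>carrier := K\<rparr>) \<and>
     H <#>\<^bsub>G\<^esub> N = K \<and> H \<inter> N = {\<one>\<^bsub>G\<^esub>}"

text \<open>\<open>K = (\<cdots>((S 0 \<ltimes> S 1) \<ltimes> S 2) \<ltimes> \<cdots>) \<ltimes> S n\<close> inside \<open>G\<close>.\<close>

primrec iterated_semidirect ::
    "('g, 'm) monoid_scheme \<Rightarrow> (nat \<Rightarrow> 'g set) \<Rightarrow> nat \<Rightarrow> 'g set \<Rightarrow> bool" where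
  "iterated_semidirect G S 0 K \<longleftrightarrow> subgroup K G \<and> K = S 0"
| "iterated_semidirect G S (Suc n) K \<longleftrightarrow>
     (\<exists>H. iterated_semidirect G S n H \<and> internal_semidirect G K H (S (Suc n)))"

definition internal_direct_product ::
    "('g, 'm) monoid_scheme \<Rightarrow> 'i set \<Rightarrow> ('i \<Rightarrow> 'g set) \<Rightarrow> 'g set \<Rightarrow> bool" where
  "internal_direct_product G I S K \<longleftrightarrow>
     subgroup K G \<and> (\<forall>i\<in>I. S i \<lhd> (G\<lparr>carrier := K\<rparr>)) \<and>
     generate G (\<Union>i\<in>I. S i) = K \<and>
     (\<forall>i\<in>I. S i \<inter> generate G (\<Union>j\<in>I - {i}. S j) = {\<one>\<^bsub>G\<^esub>})"


section \<open>Automorphisms and stabilisers\<close>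

text \<open>
  Automorphisms act on the right, so the product of \<open>\<phi>\<close> and \<open>\<psi>\<close> is \<open>\<phi>\<close> followed by \<open>\<psi>\<close>; the
  multiplication of the library's \<open>AutoGroup\<close> is composition in the other order.
\<close>

definition right_AutoGroup :: "('g, 'm) monoid_scheme \<Rightarrow> ('g \<Rightarrow> 'g) monoid" where
  "right_AutoGroup G = (AutoGroup G)\<lparr>mult := \<lambda>\<phi> \<psi>. \<psi> \<otimes>\<^bsub>AutoGroup G\<^esub> \<phi>\<rparr>"

abbreviation Aut_raag ::
    "'v set \<Rightarrow> 'v set set \<Rightarrow> (('v \<times> bool) list set \<Rightarrow> ('v \<times> bool) list set) monoid" where
  "Aut_raag X E \<equiv> right_AutoGroup (raag X E)"

definition StK ::
    "'v set \<Rightarrow> 'v set set \<Rightarrow> (('v \<times> bool) list set \<Rightarrow> ('v \<times> bool) list set) set" where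
  "StK X E = {\<phi> \<in> carrier (Aut_raag X E).
     \<forall>Y \<in> admissible_sets X E. \<phi> ` raag_on X E Y = raag_on X E Y}"

definition St_level ::
    "'v set \<Rightarrow> 'v set set \<Rightarrow> nat \<Rightarrow> (('v \<times> bool) list set \<Rightarrow> ('v \<times> bool) list set) set" where
  "St_level X E k = {\<phi> \<in> StK X E. \<forall>y \<in> X - level X E k. \<phi> (gen X E y) = gen X E y}"

definition St_class ::
    "'v set \<Rightarrow> 'v set set \<Rightarrow> 'v \<Rightarrow> (('v \<times> bool) list set \<Rightarrow> ('v \<times> bool) list set) set" where
  "St_class X E x = {\<phi> \<in> StK X E. \<forall>y \<in> X - sim X E `` {x}. \<phi> (gen X E y) = gen X E y}"


section \<open>The constructions are groups\<close>

lemma raag_rel_words: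
  "(u, v) \<in> raag_rel X E \<Longrightarrow> u \<in> raag_words X \<and> v \<in> raag_words X"
  by (induction rule: raag_rel.induct) (auto simp: raag_words_def)

lemma equiv_raag_rel: "equiv (raag_words X) (raag_rel X E)"
proof (rule equivI)
  show "raag_rel X E \<subseteq> raag_words X \<times> raag_words X"
    using raag_rel_words by auto
  show "refl_on (raag_words X) (raag_rel X E)"
    by (rule refl_onI) (rule raag_rel.refl)
  show "Relation.sym (raag_rel X E)"
    by (rule symI) (rule raag_rel.sym)
  show "Relation.trans (raag_rel X E)"
    by (rule transI) (rule raag_rel.trans)
qed

lemma raag_mult_class:
  assumes "u \<in> raag_words X" "v \<in> raag_words X"
  shows "(raag_rel X E `` {u}) \<otimes>\<^bsub>raag X E\<^esub> (raag_rel X E `` {v}) = raag_rel X E `` {u @ v}"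
proof -
  have "raag_rel X E `` {u' @ v'} = raag_rel X E `` {u @ v}"
    if "(u, u') \<in> raag_rel X E" "(v, v') \<in> raag_rel X E" for u' v'
    using equiv_class_eq[OF equiv_raag_rel raag_rel.append[OF that]] by simp
  moreover have "u \<in> raag_rel X E `` {u}" "v \<in> raag_rel X E `` {v}"
    using assms by (simp_all add: raag_rel.refl)
  ultimately have "(\<Union>u'\<in>raag_rel X E `` {u}. \<Union>v'\<in>raag_rel X E `` {v}. raag_rel X E `` {u' @ v'})
      = raag_rel X E `` {u @ v}"
    by blast
  then show ?thesis by (simp add: raag_def)
qed

lemma raag_word_inverse:
  "w \<in> raag_words X \<Longrightarrow> \<exists>v \<in> raag_words X. (v @ w, []) \<in> raag_rel X E"
proof (induction w)
  case Nil
  show ?case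
    using raag_rel.refl[of "[]" X E] by (intro bexI[of _ "[]"]) (simp_all add: raag_words_def)
next
  case (Cons a w)
  obtain x b where a: "a = (x, b)" by force
  with Cons have x: "x \<in> X" and w: "w \<in> raag_words X"
    by (auto simp: raag_words_def)
  then obtain v where v: "v \<in> raag_words X" "(v @ w, []) \<in> raag_rel X E"
    using Cons.IH by blast
  have "([(x, \<not> b), (x, b)], []) \<in> raag_rel X E"
    using raag_rel.cancel[OF x, where b = "\<not> b"] by simp
  then have "(v @ [(x, \<not> b), (x, b)] @ w, v @ [] @ w) \<in> raag_rel X E"
    using v(1) w by (intro raag_rel.append) (auto intro: raag_rel.refl)
  then have "((v @ [(x, \<not> b)]) @ a # w, []) \<in> raag_rel X E"
    using raag_rel.trans[OF _ v(2)] a by simp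
  moreover have "v @ [(x, \<not> b)] \<in> raag_words X"
    using v(1) x by (auto simp: raag_words_def)
  ultimately show ?case by blast
qed

lemma group_raag: "group (raag X E)"
proof (rule groupI)
  have app: "u @ v \<in> raag_words X" if "u \<in> raag_words X" "v \<in> raag_words X" for u v
    using that by (auto simp: raag_words_def)
  have nil: "[] \<in> raag_words X" by (simp add: raag_words_def)
  have car: "carrier (raag X E) = raag_words X // raag_rel X E"
    and one: "\<one>\<^bsub>raag X E\<^esub> = raag_rel X E `` {[]}"
    by (simp_all add: raag_def)
  show "\<one>\<^bsub>raag X E\<^esub> \<in> carrier (raag X E)"
    unfolding car one by (rule quotientI[OF nil])
  fix A assume "A \<in> carrier (raag X E)"
  then obtain u where u: "u \<in> raag_words X" "A = raag_rel X E `` {u}"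
    unfolding car by (rule quotientE)
  show "\<one>\<^bsub>raag X E\<^esub> \<otimes>\<^bsub>raag X E\<^esub> A = A"
    unfolding one u(2) by (simp add: raag_mult_class[OF nil u(1)])
  obtain w where w: "w \<in> raag_words X" "(w @ u, []) \<in> raag_rel X E"
    using raag_word_inverse[OF u(1)] by blast
  have "raag_rel X E `` {w} \<otimes>\<^bsub>raag X E\<^esub> A = \<one>\<^bsub>raag X E\<^esub>"
    unfolding one u(2) raag_mult_class[OF w(1) u(1)]
    by (rule equiv_class_eq[OF equiv_raag_rel w(2)])
  then show "\<exists>B \<in> carrier (raag X E). B \<otimes>\<^bsub>raag X E\<^esub> A = \<one>\<^bsub>raag X E\<^esub>"
    unfolding car using quotientI[OF w(1)] by blast
  fix B assume "B \<in> carrier (raag X E)"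
  then obtain v where v: "v \<in> raag_words X" "B = raag_rel X E `` {v}"
    unfolding car by (rule quotientE)
  show "A \<otimes>\<^bsub>raag X E\<^esub> B \<in> carrier (raag X E)"
    unfolding u(2) v(2) raag_mult_class[OF u(1) v(1)] car
    by (rule quotientI[OF app[OF u(1) v(1)]])
  fix D assume "D \<in> carrier (raag X E)"
  then obtain w where w: "w \<in> raag_words X" "D = raag_rel X E `` {w}"
    unfolding car by (rule quotientE)
  show "A \<otimes>\<^bsub>raag X E\<^esub> B \<otimes>\<^bsub>raag X E\<^esub> D = A \<otimes>\<^bsub>raag X E\<^esub> (B \<otimes>\<^bsub>raag X E\<^esub> D)"
    unfolding u(2) v(2) w(2) by (simp add: raag_mult_class u(1) v(1) w(1) app)
qed

lemma gen_closed: "x \<in> X \<Longrightarrow> gen X E x \<in> carrier (raag X E)"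
  by (auto simp: gen_def raag_def raag_words_def intro!: quotientI)

lemma (in group) group_right_AutoGroup: "group (right_AutoGroup G)"
proof -
  interpret A: group "AutoGroup G" by (rule AutoGroup)
  show ?thesis
  proof (rule groupI)
    fix \<phi> assume "\<phi> \<in> carrier (right_AutoGroup G)"
    then have "\<phi> \<in> carrier (AutoGroup G)" by (simp add: right_AutoGroup_def)
    then have "inv\<^bsub>AutoGroup G\<^esub> \<phi> \<in> carrier (right_AutoGroup G)"
      and "inv\<^bsub>AutoGroup G\<^esub> \<phi> \<otimes>\<^bsub>right_AutoGroup G\<^esub> \<phi> = \<one>\<^bsub>right_AutoGroup G\<^esub>"
      by (simp_all add: right_AutoGroup_def)
    then show "\<exists>\<psi> \<in> carrier (right_AutoGroup G).
        \<psi> \<otimes>\<^bsub>right_AutoGroup G\<^esub> \<phi> = \<one>\<^bsub>right_AutoGroup G\<^esub>"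
      by blast
  qed (simp_all add: right_AutoGroup_def A.m_assoc)
qed

lemma right_AutoGroup_mult:
  assumes "\<phi> \<in> carrier (right_AutoGroup G)" "\<psi> \<in> carrier (right_AutoGroup G)"
    and "g \<in> carrier G"
  shows "(\<phi> \<otimes>\<^bsub>right_AutoGroup G\<^esub> \<psi>) g = \<psi> (\<phi> g)"
  using assms
  by (simp add: right_AutoGroup_def AutoGroup_def BijGroup_def auto_def compose_def)

end

theory Submission
  imports Defs
begin

text \<open>
  Let \<open>\<phi>\<close> stabilise \<open>\<K>\<close> and let \<open>S\<close> be a set of vertices. The map that agrees with \<open>\<phi>\<close> on \<open>S\<close> and
  fixes the other generators extends to an endomorphism: if \<open>x \<in> S\<close> is adjacent to \<open>y \<notin> S\<close>, then
  \<open>x\<phi>\<close> lies in the subgroup of \<open>\<aa>(x) \<subseteq> st(y)\<close>, which commutes with \<open>y\<close>. If moreover \<open>\<phi>\<close> fixes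
  \<open>\<aa>(x) - S\<close> for all \<open>x \<in> S\<close>, then the map built in the same way from \<open>\<phi>\<inverse>\<close> is an inverse, so that
  \<open>\<phi>\<close> splits as a product of an element of \<open>St(\<K>)\<close> fixing \<open>X - S\<close> and one fixing \<open>S\<close>. Part (i) takes
  for \<open>S\<close> the vertices of height at most \<open>k\<close>, part (ii) a single class.
\<close>

section \<open>The universal property\<close>

primrec word_val :: "('h, 'm) monoid_scheme \<Rightarrow> ('v \<Rightarrow> 'h) \<Rightarrow> ('v \<times> bool) list \<Rightarrow> 'h" where
  "word_val H f [] = \<one>\<^bsub>H\<^esub>"
| "word_val H f (l # w) =
     (if snd l then f (fst l) else inv\<^bsub>H\<^esub> f (fst l)) \<otimes>\<^bsub>H\<^esub> word_val H f w"

context group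
begin

lemma word_val_closed:
  "f \<in> X \<rightarrow> carrier G \<Longrightarrow> w \<in> raag_words X \<Longrightarrow> word_val G f w \<in> carrier G"
  by (induction w) (auto simp: raag_words_def Pi_iff)

lemma word_val_append:
  "f \<in> X \<rightarrow> carrier G \<Longrightarrow> u \<in> raag_words X \<Longrightarrow> v \<in> raag_words X \<Longrightarrow>
    word_val G f (u @ v) = word_val G f u \<otimes> word_val G f v"
proof (induction u)
  case (Cons l u)
  then have "u \<in> raag_words X" "f (fst l) \<in> carrier G" by (auto simp: raag_words_def)
  with Cons word_val_closed[of f X] show ?case by (auto simp: m_assoc)
qed (simp add: word_val_closed)

text \<open>As \<open>raag_rel\<close> is the least congruence containing the relators, induction
  leaves only these to check: \<open>cancel\<close> holds in every group and \<open>commute\<close>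
  is the hypothesis \<open>comm\<close>.\<close>

lemma word_val_raag_rel:
  assumes f: "f \<in> X \<rightarrow> carrier G"
    and comm: "\<And>x y. x \<in> X \<Longrightarrow> y \<in> X \<Longrightarrow> {x, y} \<in> E \<Longrightarrow> f x \<otimes> f y = f y \<otimes> f x"
    and "(u, v) \<in> raag_rel X E"
  shows "word_val G f u = word_val G f v"
  using assms(3)
proof (induction rule: raag_rel.induct)
  case (append u u' v v')
  then show ?case using raag_rel_words[of _ _ X E] word_val_append[OF f] by metis
next
  case (cancel x b)
  then have "f x \<in> carrier G" using f by auto
  then show ?case by auto
next
  case (commute x y)
  then have "f x \<in> carrier G" "f y \<in> carrier G" using f by auto
  then show ?case using comm[OF commute] by simp
qed auto

text \<open>Evaluation of words is constant on classes and therefore descends to the group.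
  Extensionality is recorded because automorphisms in \<open>AutoGroup\<close> are required to be
  extensional on the carrier.\<close>

lemma raag_universal:
  assumes f: "f \<in> X \<rightarrow> carrier G"
    and comm: "\<And>x y. x \<in> X \<Longrightarrow> y \<in> X \<Longrightarrow> {x, y} \<in> E \<Longrightarrow> f x \<otimes> f y = f y \<otimes> f x"
  obtains h where "h \<in> hom (raag X E) G" "h \<in> extensional (carrier (raag X E))"
    "\<And>x. x \<in> X \<Longrightarrow> h (gen X E x) = f x"
proof
  \<comment> \<open>All words in a class have the same value, so the image of the class is a
    singleton and \<open>the_elem\<close> extracts that value.\<close>
  define h where
    "h = restrict (\<lambda>A. the_elem (word_val G f ` A)) (carrier (raag X E))"
  have car: "carrier (raag X E) = raag_words X // raag_rel X E"
    by (simp add: raag_def)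
  have h: "h (raag_rel X E `` {u}) = word_val G f u" if "u \<in> raag_words X" for u
  proof -
    have "word_val G f ` (raag_rel X E `` {u}) = {word_val G f u}"
      using word_val_raag_rel[OF f comm] raag_rel.refl[OF that] by fastforce
    then show ?thesis using that by (simp add: h_def car quotientI)
  qed
  show "h \<in> extensional (carrier (raag X E))" by (simp add: h_def)
  show "h \<in> hom (raag X E) G"
  proof (rule homI)
    fix A assume "A \<in> carrier (raag X E)"
    then obtain u where u: "u \<in> raag_words X" "A = raag_rel X E `` {u}"
      unfolding car by (rule quotientE)
    then show "h A \<in> carrier G" using h word_val_closed[OF f] by simp
    fix B assume "B \<in> carrier (raag X E)"
    then obtain v where v: "v \<in> raag_words X" "B = raag_rel X E `` {v}"
      unfolding car by (rule quotientE)
    have "u @ v \<in> raag_words X" using u v by (simp add: raag_words_def)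
    then show "h (A \<otimes>\<^bsub>raag X E\<^esub> B) = h A \<otimes> h B"
      using u v h word_val_append[OF f] by (simp add: raag_mult_class)
  qed
  show "h (gen X E x) = f x" if "x \<in> X" for x
    using that f h[of "[(x, True)]"] by (auto simp: gen_def raag_words_def Pi_iff)
qed

end

section \<open>Subgroups generated by sets of vertices\<close>

lemma raag_on_closed:
  assumes "Y \<subseteq> X" shows "subgroup (raag_on X E Y) (raag X E)"
  unfolding raag_on_def using assms gen_closed[of _ X E]
  by (intro group.generate_is_subgroup[OF group_raag]) auto

lemma gen_in_raag_on: "x \<in> Y \<Longrightarrow> gen X E x \<in> raag_on X E Y"
  unfolding raag_on_def by (intro generate.incl imageI)

text \<open>A word is a product of letters, each of which is a generator or the inverse of one. With
  this, facts about \<open>raag_on X E Y\<close> yield facts about the whole group at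
  \<open>Y = X\<close>.\<close>

lemma raag_on_all: "raag_on X E X = carrier (raag X E)"
proof
  interpret group "raag X E" by (rule group_raag)
  interpret S: subgroup "raag_on X E X" "raag X E" by (rule raag_on_closed) simp
  show "raag_on X E X \<subseteq> carrier (raag X E)" by (rule S.subset)
  have letter: "raag_rel X E `` {[(x, b)]} \<in> raag_on X E X" if x: "x \<in> X" for x b
  proof (cases b)
    case True
    then show ?thesis using gen_in_raag_on[OF x, of X E] by (simp add: gen_def)
  next
    case False
    have w: "[(x, c)] \<in> raag_words X" for c using x by (simp add: raag_words_def)
    \<comment> \<open>This relator makes the class of the negative letter a left inverse of the
      generator.\<close>
    have "([(x, False), (x, True)], []) \<in> raag_rel X E"
      using raag_rel.cancel[OF x, of False E] by simp
    then have "raag_rel X E `` {[(x, False)]} \<otimes>\<^bsub>raag X E\<^esub> gen X E x = \<one>\<^bsub>raag X E\<^esub>"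
      using equiv_class_eq[OF equiv_raag_rel]
      by (simp add: gen_def raag_mult_class[OF w w]) (simp add: raag_def)
    moreover have "raag_rel X E `` {[(x, False)]} \<in> carrier (raag X E)"
      using w by (simp add: raag_def quotientI)
    ultimately have "raag_rel X E `` {[(x, False)]} = inv\<^bsub>raag X E\<^esub> gen X E x"
      using gen_closed[OF x] by (simp add: inv_equality)
    then show ?thesis using False gen_in_raag_on[OF x] S.m_inv_closed by simp
  qed
  have "raag_rel X E `` {w} \<in> raag_on X E X" if "w \<in> raag_words X" for w
    using that
  proof (induction w)
    case Nil
    then show ?case using S.one_closed by (simp add: raag_def)
  next
    case (Cons l w)
    then have w: "[l] \<in> raag_words X" "w \<in> raag_words X" "fst l \<in> X"
      by (auto simp: raag_words_def)
    have "raag_rel X E `` {[l]} \<in> raag_on X E X" using letter[OF w(3), of "snd l"] by simp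
    with Cons.IH[OF w(2)] raag_mult_class[OF w(1,2), of E] S.m_closed show ?case by fastforce
  qed
  then show "carrier (raag X E) \<subseteq> raag_on X E X"
    by (auto simp: raag_def elim!: quotientE)
qed

text \<open>For \<open>Y = X\<close> this says that generators determine a homomorphism. The
  splitting arguments need it for an admissible set \<open>Y\<close>, on whose generators two
  otherwise different homomorphisms agree.\<close>

lemma raag_hom_eq_on:
  assumes Y: "Y \<subseteq> X" and H: "group H" and h: "h \<in> hom (raag X E) H" and k: "k \<in> hom (raag X E) H"
    and eq: "\<And>y. y \<in> Y \<Longrightarrow> h (gen X E y) = k (gen X E y)" and g: "g \<in> raag_on X E Y"
  shows "h g = k g"
proof -
  interpret h: group_hom "raag X E" H h
    using group_raag H h by (simp add: group_hom_def group_hom_axioms_def)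
  interpret k: group_hom "raag X E" H k
    using group_raag H k by (simp add: group_hom_def group_hom_axioms_def)
  have sub: "g \<in> carrier (raag X E)" if "g \<in> raag_on X E Y" for g
    using that subgroup.subset[OF raag_on_closed[OF Y]] by auto
  show ?thesis using g unfolding raag_on_def
  proof (induction rule: generate.induct)
    case (inv g)
    then show ?case using eq Y gen_closed[of _ X E] by auto
  next
    case (eng g g')
    then show ?case using sub by (simp add: raag_on_def)
  qed (use eq in auto)
qed

text \<open>Applied with \<open>Y\<close> and \<open>Z\<close> the same admissible set, to see that
  a map given on generators preserves its subgroup.\<close>

lemma raag_hom_image:
  assumes Y: "Y \<subseteq> X" and h: "h \<in> hom (raag X E) (raag X E)" and Z: "Z \<subseteq> X"
    and im: "\<And>y. y \<in> Y \<Longrightarrow> h (gen X E y) \<in> raag_on X E Z" and g: "g \<in> raag_on X E Y"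
  shows "h g \<in> raag_on X E Z"
proof -
  interpret h: group_hom "raag X E" "raag X E" h
    using group_raag h by (simp add: group_hom_def group_hom_axioms_def)
  interpret S: subgroup "raag_on X E Z" "raag X E" by (rule raag_on_closed[OF Z])
  have sub: "g \<in> carrier (raag X E)" if "g \<in> raag_on X E Y" for g
    using that subgroup.subset[OF raag_on_closed[OF Y]] by auto
  show ?thesis using g unfolding raag_on_def[of X E Y]
  proof (induction rule: generate.induct)
    case (inv g)
    then show ?case using im Y gen_closed[of _ X E] by auto
  next
    case (eng g g')
    then show ?case using sub by (simp add: raag_on_def[of X E Y])
  qed (use im in auto)
qed

text \<open>The elements commuting with \<open>z\<close> form a subgroup, so only generators
  matter.\<close>

lemma raag_on_commute:
  assumes Y: "Y \<subseteq> X" and g: "g \<in> raag_on X E Y" and z: "z \<in> carrier (raag X E)"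
    and comm: "\<And>y. y \<in> Y \<Longrightarrow> gen X E y \<otimes>\<^bsub>raag X E\<^esub> z = z \<otimes>\<^bsub>raag X E\<^esub> gen X E y"
  shows "g \<otimes>\<^bsub>raag X E\<^esub> z = z \<otimes>\<^bsub>raag X E\<^esub> g"
proof -
  interpret group "raag X E" by (rule group_raag)
  have sub: "g \<in> carrier (raag X E)" if "g \<in> raag_on X E Y" for g
    using that subgroup.subset[OF raag_on_closed[OF Y]] by auto
  show ?thesis using g unfolding raag_on_def
  proof (induction rule: generate.induct)
    case (inv g)
    then have g: "g \<in> carrier (raag X E)" "g \<otimes>\<^bsub>raag X E\<^esub> z = z \<otimes>\<^bsub>raag X E\<^esub> g"
      using comm Y gen_closed[of _ X E] by auto
    then have "z = inv\<^bsub>raag X E\<^esub> g \<otimes>\<^bsub>raag X E\<^esub> (z \<otimes>\<^bsub>raag X E\<^esub> g)"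
      using z by (metis inv_closed l_inv l_one m_assoc)
    then show ?case using g z by (metis inv_closed m_assoc m_closed r_inv r_one)
  next
    case (eng g g')
    then show ?case using sub z by (metis m_assoc raag_on_def)
  qed (use comm z in auto)
qed

lemma gen_commute:
  assumes "x \<in> X" "y \<in> X" "{x, y} \<in> E"
  shows "gen X E x \<otimes>\<^bsub>raag X E\<^esub> gen X E y = gen X E y \<otimes>\<^bsub>raag X E\<^esub> gen X E x"
  using equiv_class_eq[OF equiv_raag_rel raag_rel.commute[OF assms]] assms
  by (simp add: gen_def raag_mult_class raag_words_def)


section \<open>Admissible sets and heights\<close>

locale raag_graph =
  fixes X :: "'v set" and E :: "'v set set"
  assumes graph: "finite_simple_graph X E"
begin

lemma finite_X: "finite X"
  using graph by (simp add: finite_simple_graph_def)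

lemma lk_sym: "y \<in> lk E x \<longleftrightarrow> x \<in> lk E y"
  by (simp add: lk_def insert_commute)

lemma not_in_lk: "x \<notin> lk E x"
  using graph by (auto simp: finite_simple_graph_def lk_def)

text \<open>Symmetry of adjacency turns the intersection of stars into the domination relation
  between vertices, the form used from here on.\<close>

lemma adm_iff: "z \<in> adm X E x \<longleftrightarrow> z \<in> X \<and> lk E x \<subseteq> st E z"
  using lk_sym by (auto simp: adm_def st_def)

lemma adm_subset: "adm X E x \<subseteq> X"
  by (auto simp: adm_def)

lemma adm_refl: "x \<in> X \<Longrightarrow> x \<in> adm X E x"
  by (auto simp: adm_iff st_def)

text \<open>This is transitivity of domination. A neighbour \<open>u\<close> of \<open>x\<close>
  other than \<open>y\<close> is also a neighbour of \<open>y\<close>, hence in the star of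
  \<open>z\<close>. If \<open>u = y\<close>, then \<open>x\<close> is a neighbour of
  \<open>y\<close> and so lies in the star of \<open>z\<close>; either \<open>x = z\<close>, or
  \<open>z\<close> is a neighbour of \<open>x\<close> and so lies in the star of
  \<open>y\<close>.\<close>

lemma adm_trans: "y \<in> adm X E x \<Longrightarrow> adm X E y \<subseteq> adm X E x"
proof
  fix z assume y: "y \<in> adm X E x" and z: "z \<in> adm X E y"
  have "u \<in> st E z" if u: "u \<in> lk E x" for u
  proof (cases "u = y")
    case True
    then have "x \<in> lk E y" using u lk_sym by simp
    then have "x = z \<or> z \<in> lk E x" using z lk_sym by (auto simp: adm_iff st_def)
    then show ?thesis using True u y lk_sym by (auto simp: adm_iff st_def)
  next
    case False
    then have "u \<in> lk E y" using u y by (auto simp: adm_iff st_def)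
    then show ?thesis using z by (auto simp: adm_iff)
  qed
  then show "z \<in> adm X E x" using z by (auto simp: adm_iff)
qed

text \<open>Both sides express mutual domination. For vertices dominating each other, the stars
  coincide if they are adjacent and the links coincide if they are not.\<close>

lemma sim_iff: "(x, y) \<in> sim X E \<longleftrightarrow> x \<in> X \<and> y \<in> X \<and> adm X E x = adm X E y"
proof -
  have "st E x = st E y \<or> lk E x = lk E y \<longleftrightarrow> lk E x \<subseteq> st E y \<and> lk E y \<subseteq> st E x"
    using lk_sym not_in_lk by (auto simp: st_def)
  moreover have "adm X E x = adm X E y \<longleftrightarrow> lk E x \<subseteq> st E y \<and> lk E y \<subseteq> st E x"
    if "x \<in> X" "y \<in> X"
    using that adm_iff adm_refl adm_trans by blast
  ultimately show ?thesis by (auto simp: sim_def)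
qed

section \<open>Chains of admissible sets and heights\<close>

definition chain_to :: "'v \<Rightarrow> nat \<Rightarrow> bool" where
  "chain_to x i \<longleftrightarrow> (\<exists>c :: nat \<Rightarrow> 'v. c i = x \<and> (\<forall>j\<le>i. c j \<in> X) \<and>
     (\<forall>j<i. adm X E (c j) \<subset> adm X E (c (Suc j))))"

lemma height_def': "height X E x = (GREATEST i. chain_to x i)"
  by (simp add: height_def chain_to_def)

text \<open>Cardinality grows by at least one at each step of a chain. The bound is what makes the
  \<open>GREATEST\<close> in \<open>height\<close> attained.\<close>

lemma chain_to_le_card: "chain_to x i \<Longrightarrow> i \<le> card X"
proof -
  assume "chain_to x i"
  then obtain c where c: "\<And>j. j < i \<Longrightarrow> adm X E (c j) \<subset> adm X E (c (Suc j))"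
    by (auto simp: chain_to_def)
  have "j \<le> i \<Longrightarrow> j \<le> card (adm X E (c j))" for j
  proof (induction j)
    case (Suc j)
    then have "card (adm X E (c j)) < card (adm X E (c (Suc j)))"
      using c by (intro psubset_card_mono finite_subset[OF adm_subset finite_X]) auto
    with Suc show ?case by simp
  qed simp
  from this[of i] show ?thesis using card_mono[OF finite_X adm_subset, of "c i"] by simp
qed

lemma chain_to_height: "x \<in> X \<Longrightarrow> chain_to x (height X E x)"
  unfolding height_def'
  \<comment> \<open>The value \<open>0\<close> is realised by the chain consisting of
    \<open>x\<close> alone.\<close>
  by (rule GreatestI_nat[of _ 0 "card X"]) (auto simp: chain_to_le_card, auto simp: chain_to_def)

lemma le_height: "chain_to x i \<Longrightarrow> i \<le> height X E x"
  unfolding height_def' by (rule Greatest_le_nat[of _ _ "card X"]) (auto simp: chain_to_le_card)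

text \<open>Replace the top \<open>y\<close> of a longest chain by \<open>x\<close>: the last
  inclusion stays strict because its larger side can only grow.\<close>

lemma height_mono:
  assumes "x \<in> X" "y \<in> X" "adm X E y \<subseteq> adm X E x"
  shows "height X E y \<le> height X E x"
proof -
  obtain c where c: "c (height X E y) = y" "\<forall>j\<le>height X E y. c j \<in> X"
      "\<forall>j<height X E y. adm X E (c j) \<subset> adm X E (c (Suc j))"
    using chain_to_height[OF assms(2)] by (auto simp: chain_to_def)
  have "chain_to x (height X E y)"
    unfolding chain_to_def
  proof (intro exI[of _ "c(height X E y := x)"] conjI allI impI)
    fix j assume j: "j < height X E y"
    then have "adm X E (c j) \<subset> adm X E (c (Suc j))" using c by simp
    then show "adm X E ((c(height X E y := x)) j) \<subset> adm X E ((c(height X E y := x)) (Suc j))"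
      using j c(1) assms(3) by (cases "Suc j = height X E y") auto
  qed (use c assms in auto)
  then show ?thesis by (rule le_height)
qed

text \<open>Here \<open>x\<close> can be put on top of a longest chain ending in
  \<open>y\<close>.\<close>

lemma height_strict_mono:
  assumes "x \<in> X" "y \<in> X" "adm X E y \<subset> adm X E x"
  shows "height X E y < height X E x"
proof -
  obtain c where c: "c (height X E y) = y" "\<forall>j\<le>height X E y. c j \<in> X"
      "\<forall>j<height X E y. adm X E (c j) \<subset> adm X E (c (Suc j))"
    using chain_to_height[OF assms(2)] by (auto simp: chain_to_def)
  have "chain_to x (Suc (height X E y))"
    unfolding chain_to_def
  proof (intro exI[of _ "c(Suc (height X E y) := x)"] conjI allI impI)
    fix j assume j: "j < Suc (height X E y)"
    then show "adm X E ((c(Suc (height X E y) := x)) j)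
        \<subset> adm X E ((c(Suc (height X E y) := x)) (Suc j))"
      using c assms(3) by (cases "j = height X E y") auto
  qed (use c assms in \<open>auto simp: le_Suc_eq\<close>)
  then show ?thesis using le_height by fastforce
qed

text \<open>By \<open>adm_trans\<close> the admissible set of \<open>y\<close> is contained in that
  of \<open>x\<close>; equality gives equivalence, strict inclusion a smaller height. This
  triangular structure drives both decompositions.\<close>

lemma height_adm:
  assumes "x \<in> X" "y \<in> adm X E x"
  shows "(x, y) \<in> sim X E \<or> height X E y < height X E x"
proof -
  have "y \<in> X" using assms(2) adm_subset by blast
  with assms show ?thesis
    using adm_trans[OF assms(2)] height_strict_mono[of x y] sim_iff[of x y] by blast
qed

lemma height_sim: "(x, y) \<in> sim X E \<Longrightarrow> height X E x = height X E y"
  using height_mono[of x y] height_mono[of y x] by (auto simp: sim_iff)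

lemma height_adm_le: "x \<in> X \<Longrightarrow> y \<in> adm X E x \<Longrightarrow> height X E y \<le> height X E x"
  using height_adm[of x y] height_sim[of x y] by fastforce

lemma sim_class_subset_level: "height X E x = k \<Longrightarrow> sim X E `` {x} \<subseteq> level X E k"
  using height_sim by (auto simp: level_def sim_iff)


section \<open>Fixators in the stabiliser\<close>

abbreviation G where "G \<equiv> raag X E"
abbreviation A where "A \<equiv> Aut_raag X E"

text \<open>A common form for \<open>StK\<close>, \<open>St_level\<close> and
  \<open>St_class\<close>, so that normality and splitting are proved once; intersections become
  unions of fixed sets.\<close>

definition Fix :: "'v set \<Rightarrow> (('v \<times> bool) list set \<Rightarrow> ('v \<times> bool) list set) set" where
  "Fix B = {\<phi> \<in> StK X E. \<forall>y\<in>B. \<phi> (gen X E y) = gen X E y}"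

lemma StK_eq_Fix: "StK X E = Fix {}"
  and St_level_eq_Fix: "St_level X E k = Fix (X - level X E k)"
  and St_class_eq_Fix: "St_class X E x = Fix (X - sim X E `` {x})"
  by (auto simp: Fix_def St_level_def St_class_def)

sublocale G: group G by (rule group_raag)
sublocale A: group A by (rule G.group_right_AutoGroup)

section \<open>Automorphisms acting on the right\<close>

lemma Aut_iff: "\<phi> \<in> carrier A \<longleftrightarrow>
    \<phi> \<in> hom G G \<and> \<phi> \<in> extensional (carrier G) \<and> bij_betw \<phi> (carrier G) (carrier G)"
  by (auto simp: right_AutoGroup_def AutoGroup_def auto_def Bij_def)

lemma Aut_one: "g \<in> carrier G \<Longrightarrow> \<one>\<^bsub>A\<^esub> g = g"
  by (simp add: right_AutoGroup_def AutoGroup_def BijGroup_def)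

lemma Aut_closed: "\<phi> \<in> carrier A \<Longrightarrow> g \<in> carrier G \<Longrightarrow> \<phi> g \<in> carrier G"
  by (auto simp: Aut_iff hom_def)

lemma Aut_mult:
  "\<phi> \<in> carrier A \<Longrightarrow> \<psi> \<in> carrier A \<Longrightarrow> g \<in> carrier G \<Longrightarrow> (\<phi> \<otimes>\<^bsub>A\<^esub> \<psi>) g = \<psi> (\<phi> g)"
  by (rule right_AutoGroup_mult)

lemma Aut_inv:
  assumes "\<phi> \<in> carrier A" "g \<in> carrier G"
  shows "\<phi> ((inv\<^bsub>A\<^esub> \<phi>) g) = g" "(inv\<^bsub>A\<^esub> \<phi>) (\<phi> g) = g"
  using assms Aut_mult[of "inv\<^bsub>A\<^esub> \<phi>" \<phi> g] Aut_mult[of \<phi> "inv\<^bsub>A\<^esub> \<phi>" g] Aut_one by auto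

lemma Aut_eqI:
  assumes "\<phi> \<in> carrier A" "\<psi> \<in> carrier A"
    and "\<And>x. x \<in> X \<Longrightarrow> \<phi> (gen X E x) = \<psi> (gen X E x)"
  shows "\<phi> = \<psi>"
  using assms raag_hom_eq_on[of X X G \<phi> E \<psi>] G.is_group raag_on_all[of X E]
  by (intro extensionalityI[of _ "carrier G"]) (auto simp: Aut_iff)

lemma StK_iff: "\<phi> \<in> StK X E \<longleftrightarrow>
    \<phi> \<in> carrier A \<and> (\<forall>x\<in>X. \<phi> ` raag_on X E (adm X E x) = raag_on X E (adm X E x))"
  by (simp add: StK_def admissible_sets_def)

lemma raag_on_adm_carrier: "g \<in> raag_on X E (adm X E x) \<Longrightarrow> g \<in> carrier G"
  using subgroup.subset[OF raag_on_closed[OF adm_subset]] by blast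

lemma StK_closed:
  assumes "\<phi> \<in> StK X E" "x \<in> X" "g \<in> raag_on X E (adm X E x)"
  shows "\<phi> g \<in> raag_on X E (adm X E x)"
  using imageI[OF assms(3), of \<phi>] assms(1,2) by (simp add: StK_iff)

lemma StK_inv_image:
  assumes "\<phi> \<in> StK X E" "x \<in> X"
  shows "(inv\<^bsub>A\<^esub> \<phi>) ` raag_on X E (adm X E x) = raag_on X E (adm X E x)"
proof -
  let ?P = "raag_on X E (adm X E x)"
  have "\<phi> \<in> carrier A" "\<phi> ` ?P = ?P" using assms by (auto simp: StK_iff)
  then have "(inv\<^bsub>A\<^esub> \<phi>) ` ?P = (\<lambda>g. (inv\<^bsub>A\<^esub> \<phi>) (\<phi> g)) ` ?P" by (metis image_image)
  also have "\<dots> = id ` ?P"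
    by (rule image_cong) (simp_all add: Aut_inv \<open>\<phi> \<in> carrier A\<close> raag_on_adm_carrier[of _ x])
  finally show ?thesis by simp
qed

section \<open>Fixators as subgroups and their normality\<close>

lemma subgroup_Fix:
  assumes "B \<subseteq> X" shows "subgroup (Fix B) A"
proof (rule A.subgroupI)
  have gen: "gen X E y \<in> carrier G" if "y \<in> B" for y
    by (rule gen_closed[OF subsetD[OF assms that]])
  show "Fix B \<subseteq> carrier A" by (auto simp: Fix_def StK_iff)
  have "\<one>\<^bsub>A\<^esub> ` raag_on X E (adm X E x) = id ` raag_on X E (adm X E x)" for x
    by (rule image_cong) (simp_all add: Aut_one raag_on_adm_carrier[of _ x])
  then have "\<one>\<^bsub>A\<^esub> \<in> Fix B" using Aut_one gen by (auto simp: Fix_def StK_iff)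
  then show "Fix B \<noteq> {}" by blast
  fix \<phi> assume \<phi>: "\<phi> \<in> Fix B"
  then have \<phi>A: "\<phi> \<in> carrier A" by (simp add: Fix_def StK_iff)
  have "(inv\<^bsub>A\<^esub> \<phi>) (gen X E y) = gen X E y" if "y \<in> B" for y
    using Aut_inv(2)[OF \<phi>A gen[OF that]] \<phi> that by (simp add: Fix_def)
  then show "inv\<^bsub>A\<^esub> \<phi> \<in> Fix B"
    using \<phi> \<phi>A StK_inv_image by (auto simp: Fix_def StK_iff)
  fix \<psi> assume \<psi>: "\<psi> \<in> Fix B"
  then have \<psi>A: "\<psi> \<in> carrier A" by (simp add: Fix_def StK_iff)
  have "(\<phi> \<otimes>\<^bsub>A\<^esub> \<psi>) ` raag_on X E (adm X E x) = \<psi> ` \<phi> ` raag_on X E (adm X E x)" for x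
    unfolding image_image
    by (rule image_cong) (simp_all add: Aut_mult \<phi>A \<psi>A raag_on_adm_carrier[of _ x])
  then show "\<phi> \<otimes>\<^bsub>A\<^esub> \<psi> \<in> Fix B"
    using \<phi> \<psi> \<phi>A \<psi>A Aut_mult[OF \<phi>A \<psi>A] gen by (auto simp: Fix_def StK_iff)
qed

lemma Fix_antimono: "B \<subseteq> B' \<Longrightarrow> Fix B' \<subseteq> Fix B"
  by (auto simp: Fix_def)

lemma Fix_Int: "Fix B \<inter> Fix B' = Fix (B \<union> B')"
  by (auto simp: Fix_def)

lemma Fix_all: "Fix X = {\<one>\<^bsub>A\<^esub>}"
proof
  show "{\<one>\<^bsub>A\<^esub>} \<subseteq> Fix X" using subgroup.one_closed[OF subgroup_Fix] by blast
  show "Fix X \<subseteq> {\<one>\<^bsub>A\<^esub>}"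
  proof
    fix \<phi> assume "\<phi> \<in> Fix X"
    then have "\<phi> = \<one>\<^bsub>A\<^esub>"
      by (intro Aut_eqI) (auto simp: Fix_def StK_iff Aut_one gen_closed)
    then show "\<phi> \<in> {\<one>\<^bsub>A\<^esub>}" by simp
  qed
qed

lemma Fix_adm:
  assumes "\<phi> \<in> Fix B" "adm X E x \<subseteq> B" "g \<in> raag_on X E (adm X E x)"
  shows "\<phi> g = g"
proof -
  have "id \<in> hom G G" by (simp add: hom_def)
  moreover have "\<phi> \<in> hom G G" using assms by (simp add: Fix_def StK_iff Aut_iff)
  moreover have "\<phi> (gen X E y) = id (gen X E y)" if "y \<in> adm X E x" for y
    using assms that by (auto simp: Fix_def)
  ultimately have "\<phi> g = id g"
    using raag_hom_eq_on[OF adm_subset G.is_group] assms(3) by blast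
  then show ?thesis by simp
qed

text \<open>Products apply the left factor first. For \<open>y\<close> in \<open>B - B'\<close>, the
  conjugating \<open>\<alpha>\<close> sends the generator into the subgroup of
  \<open>adm X E y\<close>; as this set lies in \<open>B\<close>, \<open>\<beta>\<close> is the
  identity there, and the inverse of \<open>\<alpha>\<close> restores the generator. For
  \<open>y\<close> in \<open>B'\<close> all three factors fix it.\<close>

lemma normal_Fix:
  assumes "B' \<subseteq> B" "B \<subseteq> X" "\<And>y. y \<in> B - B' \<Longrightarrow> adm X E y \<subseteq> B"
  shows "Fix B \<lhd> A\<lparr>carrier := Fix B'\<rparr>"
proof -
  have "B' \<subseteq> X" using assms by blast
  then interpret S: subgroup "Fix B'" A by (rule subgroup_Fix)
  interpret K: group "A\<lparr>carrier := Fix B'\<rparr>" by (rule S.subgroup_is_group[OF A.is_group])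
  interpret N: subgroup "Fix B" A by (rule subgroup_Fix[OF assms(2)])
  show ?thesis
    unfolding K.normal_inv_iff
  proof (intro conjI ballI)
    show "subgroup (Fix B) (A\<lparr>carrier := Fix B'\<rparr>)"
      by (rule A.subgroup_incl[OF N.subgroup_axioms S.subgroup_axioms Fix_antimono[OF assms(1)]])
    fix \<alpha> \<beta> assume a: "\<alpha> \<in> carrier (A\<lparr>carrier := Fix B'\<rparr>)" and b: "\<beta> \<in> Fix B"
    then have \<alpha>: "\<alpha> \<in> Fix B'" "\<alpha> \<in> carrier A" and \<beta>: "\<beta> \<in> Fix B'" "\<beta> \<in> carrier A"
      using Fix_antimono[OF assms(1)] by auto
    have conj: "\<alpha> \<otimes>\<^bsub>A\<^esub> \<beta> \<otimes>\<^bsub>A\<^esub> inv\<^bsub>A\<^esub> \<alpha> \<in> Fix B'" using \<alpha> \<beta> by simp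
    have "(\<alpha> \<otimes>\<^bsub>A\<^esub> \<beta> \<otimes>\<^bsub>A\<^esub> inv\<^bsub>A\<^esub> \<alpha>) (gen X E y) = gen X E y" if y: "y \<in> B" for y
    proof (cases "y \<in> B'")
      case True
      then show ?thesis using conj by (simp add: Fix_def)
    next
      case False
      then have adm: "adm X E y \<subseteq> B" and yX: "y \<in> X" using assms y by auto
      have "\<alpha> \<in> StK X E" using \<alpha> by (simp add: Fix_def)
      then have "\<alpha> (gen X E y) \<in> raag_on X E (adm X E y)"
        by (rule StK_closed[OF _ yX gen_in_raag_on[OF adm_refl[OF yX]]])
      then show ?thesis
        using \<alpha> \<beta> gen_closed[OF yX] Fix_adm[OF b adm] Aut_closed[OF \<alpha>(2)]
        by (simp add: Aut_mult Aut_inv)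
    qed
    then have "\<alpha> \<otimes>\<^bsub>A\<^esub> \<beta> \<otimes>\<^bsub>A\<^esub> inv\<^bsub>A\<^esub> \<alpha> \<in> Fix B" using conj by (simp add: Fix_def)
    then show "\<alpha> \<otimes>\<^bsub>A\<lparr>carrier := Fix B'\<rparr>\<^esub> \<beta>
        \<otimes>\<^bsub>A\<lparr>carrier := Fix B'\<rparr>\<^esub> inv\<^bsub>A\<lparr>carrier := Fix B'\<rparr>\<^esub> \<alpha> \<in> Fix B"
      using A.m_inv_consistent[OF S.subgroup_axioms \<alpha>(1)] by simp
  qed
qed


section \<open>Splitting automorphisms\<close>

lemma mixed_hom:
  assumes \<phi>: "\<phi> \<in> StK X E"
  obtains \<psi> where "\<psi> \<in> hom G G" "\<psi> \<in> extensional (carrier G)"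
    "\<And>x. x \<in> X \<Longrightarrow> \<psi> (gen X E x) = (if x \<in> S then \<phi> (gen X E x) else gen X E x)"
proof -
  let ?f = "\<lambda>x. if x \<in> S then \<phi> (gen X E x) else gen X E x"
  have \<phi>A: "\<phi> \<in> carrier A" and \<phi>hom: "\<phi> \<in> hom G G" using \<phi> by (auto simp: StK_iff Aut_iff)
  \<comment> \<open>This settles edges with exactly one end in \<open>S\<close>; it is used in both
    orientations.\<close>
  have half: "\<phi> (gen X E x) \<otimes>\<^bsub>G\<^esub> gen X E y = gen X E y \<otimes>\<^bsub>G\<^esub> \<phi> (gen X E x)"
    if xy: "x \<in> X" "y \<in> X" "{x, y} \<in> E" for x y
  proof -
    have "\<phi> (gen X E x) \<in> raag_on X E (adm X E x)"
      by (rule StK_closed[OF \<phi> xy(1) gen_in_raag_on[OF adm_refl[OF xy(1)]]])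
    moreover have "gen X E z \<otimes>\<^bsub>G\<^esub> gen X E y = gen X E y \<otimes>\<^bsub>G\<^esub> gen X E z"
      if "z \<in> adm X E x" for z
    \<comment> \<open>The star of \<open>z\<close> contains \<open>y\<close> either as a neighbour
      or as \<open>z\<close> itself; the second case is trivial.\<close>
    proof (cases "z = y")
      case False
      have "y \<in> st E z" "z \<in> X" using that xy(3) by (auto simp: adm_iff lk_def)
      with False show ?thesis using gen_commute[of z X y E] xy(2) by (auto simp: st_def lk_def)
    qed simp
    ultimately show ?thesis
      using raag_on_commute[OF adm_subset _ gen_closed[OF xy(2)]] by blast
  qed
  have f: "?f \<in> X \<rightarrow> carrier G" by (simp add: gen_closed Aut_closed[OF \<phi>A])
  have comm: "?f x \<otimes>\<^bsub>G\<^esub> ?f y = ?f y \<otimes>\<^bsub>G\<^esub> ?f x" if xy: "x \<in> X" "y \<in> X" "{x, y} \<in> E" for x y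
  proof -
    have yx: "{y, x} \<in> E" using xy(3) by (simp add: insert_commute)
    have "\<phi> (gen X E x) \<otimes>\<^bsub>G\<^esub> \<phi> (gen X E y) = \<phi> (gen X E y) \<otimes>\<^bsub>G\<^esub> \<phi> (gen X E x)"
      using arg_cong[OF gen_commute[OF xy], of \<phi>] xy(1,2)
      by (simp add: hom_mult[OF \<phi>hom] gen_closed)
    then show ?thesis
      using half[OF xy] half[OF xy(2,1) yx] gen_commute[OF xy] by simp
  qed
  show ?thesis by (rule G.raag_universal[where E = E, OF f comm that])
qed

text \<open>The inverse is built from the inverse of \<open>\<phi>\<close>. For \<open>x\<close> in
  \<open>S\<close>, the image under \<open>\<phi>\<close> involves only generators from
  \<open>S \<union> B\<close>; on these the second map agrees with the inverse of
  \<open>\<phi>\<close>, by construction on \<open>S\<close> and because both fix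
  \<open>B\<close>.\<close>

lemma mixed_aut:
  assumes S: "S \<subseteq> X" "\<And>x. x \<in> S \<Longrightarrow> adm X E x \<subseteq> S \<union> B" and B: "B \<subseteq> X" and \<phi>: "\<phi> \<in> Fix B"
  obtains \<psi> where "\<psi> \<in> StK X E"
    "\<And>x. x \<in> X \<Longrightarrow> \<psi> (gen X E x) = (if x \<in> S then \<phi> (gen X E x) else gen X E x)"
proof -
  let ?P = "\<lambda>x. raag_on X E (adm X E x)"
  have \<phi>A: "\<phi> \<in> carrier A" and \<phi>K: "\<phi> \<in> StK X E" using \<phi> by (auto simp: Fix_def StK_iff)
  have inv: "inv\<^bsub>A\<^esub> \<phi> \<in> Fix B" by (rule subgroup.m_inv_closed[OF subgroup_Fix[OF B] \<phi>])
  then have invK: "inv\<^bsub>A\<^esub> \<phi> \<in> StK X E" by (simp add: Fix_def)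
  \<comment> \<open>Stated for any such map, so that it applies to \<open>\<psi>\<close> and to its
    inverse and gives both inclusions between \<open>?P x\<close> and its image.\<close>
  have maps: "\<chi> g \<in> ?P x"
    if "\<phi>' \<in> StK X E" "\<chi> \<in> hom G G" "x \<in> X" "g \<in> ?P x"
      and \<chi>: "\<And>x. x \<in> X \<Longrightarrow> \<chi> (gen X E x) = (if x \<in> S then \<phi>' (gen X E x) else gen X E x)"
    for \<phi>' \<chi> x g
  proof (rule raag_hom_image[OF adm_subset that(2) adm_subset _ that(4)])
    fix y assume y: "y \<in> adm X E x"
    then have "gen X E y \<in> ?P x" by (rule gen_in_raag_on)
    moreover have "y \<in> X" using y adm_subset by blast
    ultimately show "\<chi> (gen X E y) \<in> ?P x"
      using \<chi>[of y] StK_closed[OF that(1,3)] by simp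
  qed
  \<comment> \<open>Stated for an arbitrary pair, since it is applied once in each order.\<close>
  have inverse: "\<chi>' (\<chi> g) = g"
    if F: "\<phi>' \<in> Fix B" "\<phi>'' \<in> Fix B" and inv: "\<And>g. g \<in> carrier G \<Longrightarrow> \<phi>'' (\<phi>' g) = g"
      and hom: "\<chi> \<in> hom G G" "\<chi>' \<in> hom G G" and g: "g \<in> carrier G"
      and \<chi>: "\<And>x. x \<in> X \<Longrightarrow> \<chi> (gen X E x) = (if x \<in> S then \<phi>' (gen X E x) else gen X E x)"
      and \<chi>': "\<And>x. x \<in> X \<Longrightarrow> \<chi>' (gen X E x) = (if x \<in> S then \<phi>'' (gen X E x) else gen X E x)"
    for \<phi>' \<phi>'' \<chi> \<chi>' g
  proof -
    have K: "\<phi>' \<in> StK X E" "\<phi>'' \<in> StK X E" using F by (auto simp: Fix_def)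
    have "(\<chi>' \<circ> \<chi>) (gen X E x) = id (gen X E x)" if x: "x \<in> X" for x
    proof (cases "x \<in> S")
      case True
      have "\<phi>' (gen X E x) \<in> ?P x"
        by (rule StK_closed[OF K(1) x gen_in_raag_on[OF adm_refl[OF x]]])
      moreover have "\<chi>' (gen X E y) = \<phi>'' (gen X E y)" if "y \<in> adm X E x" for y
      proof -
        have "y \<in> X" "y \<in> S \<or> y \<in> B" using that S(2)[OF True] adm_subset by blast+
        then show ?thesis using \<chi>'[of y] F(2) by (auto simp: Fix_def)
      qed
      moreover have "\<phi>'' \<in> hom G G" using K(2) by (simp add: StK_iff Aut_iff)
      ultimately have "\<chi>' (\<phi>' (gen X E x)) = \<phi>'' (\<phi>' (gen X E x))"
        using raag_hom_eq_on[OF adm_subset G.is_group hom(2)] by blast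
      then show ?thesis using True \<chi>[OF x] inv gen_closed[OF x] by simp
    next
      case False
      then show ?thesis using \<chi>[OF x] \<chi>'[OF x] by simp
    qed
    moreover have "\<chi>' \<circ> \<chi> \<in> hom G G" "id \<in> hom G G"
      using hom by (auto simp: hom_def Pi_iff)
    ultimately have "(\<chi>' \<circ> \<chi>) g = id g"
      using raag_hom_eq_on[of X X G "\<chi>' \<circ> \<chi>" E id] G.is_group g raag_on_all by blast
    then show ?thesis by simp
  qed
  obtain \<psi> where \<psi>: "\<psi> \<in> hom G G" "\<psi> \<in> extensional (carrier G)"
    "\<And>x. x \<in> X \<Longrightarrow> \<psi> (gen X E x) = (if x \<in> S then \<phi> (gen X E x) else gen X E x)"
    using mixed_hom[OF \<phi>K] by blast
  obtain \<psi>' where \<psi>': "\<psi>' \<in> hom G G" "\<psi>' \<in> extensional (carrier G)"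
    "\<And>x. x \<in> X \<Longrightarrow> \<psi>' (gen X E x) = (if x \<in> S then (inv\<^bsub>A\<^esub> \<phi>) (gen X E x) else gen X E x)"
    using mixed_hom[OF invK] by blast
  have l: "\<psi>' (\<psi> g) = g" if "g \<in> carrier G" for g
    using inverse[OF \<phi> inv Aut_inv(2)[OF \<phi>A] \<psi>(1) \<psi>'(1) that \<psi>(3) \<psi>'(3)] .
  have r: "\<psi> (\<psi>' g) = g" if "g \<in> carrier G" for g
    using inverse[OF inv \<phi> Aut_inv(1)[OF \<phi>A] \<psi>'(1) \<psi>(1) that \<psi>'(3) \<psi>(3)] .
  have "bij_betw \<psi> (carrier G) (carrier G)"
    by (rule bij_betw_byWitness[where f' = \<psi>'])
      (use l r \<psi>(1) \<psi>'(1) in \<open>auto simp: hom_def\<close>)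
  then have \<psi>A: "\<psi> \<in> carrier A" using \<psi> by (simp add: Aut_iff)
  have "\<psi> ` ?P x = ?P x" if x: "x \<in> X" for x
  proof
    show "\<psi> ` ?P x \<subseteq> ?P x" using maps[OF \<phi>K \<psi>(1) x _ \<psi>(3)] by blast
    show "?P x \<subseteq> \<psi> ` ?P x"
    proof
      fix g assume g: "g \<in> ?P x"
      then have "\<psi>' g \<in> ?P x" using maps[OF invK \<psi>'(1) x _ \<psi>'(3)] by blast
      then show "g \<in> \<psi> ` ?P x" using r[OF raag_on_adm_carrier[OF g]] by (metis imageI)
    qed
  qed
  then have "\<psi> \<in> StK X E" using \<psi>A by (simp add: StK_iff)
  then show ?thesis using that \<psi>(3) by blast
qed

text \<open>Take \<open>\<psi>\<close> from \<open>mixed_aut\<close> and let \<open>\<chi>\<close>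
  be the inverse of \<open>\<psi>\<close> followed by \<open>\<phi>\<close>. For \<open>x\<close> in
  \<open>S\<close>, the inverse of \<open>\<psi>\<close> sends the generator into the subgroup of
  \<open>adm X E x\<close>, where \<open>\<phi>\<close> and \<open>\<psi>\<close> agree; hence
  \<open>\<chi>\<close> fixes it.\<close>

lemma Fix_split:
  assumes S: "S \<subseteq> X" "\<And>x. x \<in> S \<Longrightarrow> adm X E x \<subseteq> S \<union> B" and B: "B \<subseteq> X" and \<phi>: "\<phi> \<in> Fix B"
  obtains \<psi> \<chi> where "\<psi> \<in> Fix (B \<union> (X - S))" "\<chi> \<in> Fix (B \<union> S)" "\<phi> = \<psi> \<otimes>\<^bsub>A\<^esub> \<chi>"
proof -
  obtain \<psi> where \<psi>K: "\<psi> \<in> StK X E"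
    and \<psi>: "\<And>x. x \<in> X \<Longrightarrow> \<psi> (gen X E x) = (if x \<in> S then \<phi> (gen X E x) else gen X E x)"
    using mixed_aut[OF S B \<phi>] by blast
  have "\<psi> (gen X E y) = gen X E y" if y: "y \<in> B \<union> (X - S)" for y
  proof -
    have "y \<in> X" "y \<in> B \<or> y \<notin> S" using y B by blast+
    then show ?thesis using \<psi>[of y] \<phi> by (auto simp: Fix_def)
  qed
  then have \<psi>F: "\<psi> \<in> Fix (B \<union> (X - S))" using \<psi>K by (simp add: Fix_def)
  have A: "\<phi> \<in> carrier A" "\<psi> \<in> carrier A" using \<phi> \<psi>K by (auto simp: Fix_def StK_iff)
  let ?\<chi> = "inv\<^bsub>A\<^esub> \<psi> \<otimes>\<^bsub>A\<^esub> \<phi>"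
  have "\<psi> \<in> Fix B" using \<psi>F Fix_antimono by blast
  then have \<chi>B: "?\<chi> \<in> Fix B"
    using \<phi> subgroup_Fix[OF B] by (simp add: subgroup.m_closed subgroup.m_inv_closed)
  have "?\<chi> (gen X E x) = gen X E x" if x: "x \<in> S" for x
  proof -
    have xX: "x \<in> X" using x S(1) by blast
    have "(inv\<^bsub>A\<^esub> \<psi>) (gen X E x) \<in> raag_on X E (adm X E x)"
      using StK_inv_image[OF \<psi>K xX] gen_in_raag_on[OF adm_refl[OF xX]] by blast
    moreover have "\<phi> (gen X E y) = \<psi> (gen X E y)" if "y \<in> adm X E x" for y
    proof -
      have "y \<in> X" "y \<in> S \<or> y \<in> B" using that S(2)[OF x] adm_subset by blast+
      then show ?thesis using \<psi>[of y] \<phi> by (auto simp: Fix_def)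
    qed
    moreover have "\<phi> \<in> hom G G" "\<psi> \<in> hom G G" using A by (simp_all add: Aut_iff)
    ultimately have "\<phi> ((inv\<^bsub>A\<^esub> \<psi>) (gen X E x)) = \<psi> ((inv\<^bsub>A\<^esub> \<psi>) (gen X E x))"
      using raag_hom_eq_on[OF adm_subset G.is_group] by blast
    then show ?thesis using A gen_closed[OF xX] by (simp add: Aut_mult Aut_inv)
  qed
  then have "?\<chi> \<in> Fix (B \<union> S)" using \<chi>B by (auto simp: Fix_def)
  moreover have "\<phi> = \<psi> \<otimes>\<^bsub>A\<^esub> ?\<chi>" using A by (simp add: A.m_assoc[symmetric])
  ultimately show ?thesis using that \<psi>F by blast
qed


section \<open>The decompositions\<close>

text \<open>The induction needs the partial products explicitly: up to level \<open>n\<close> they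
  are the automorphisms in \<open>StK X E\<close> fixing every vertex of height above
  \<open>n\<close>.\<close>

lemma iterated_semidirect_Fix:
  "iterated_semidirect A (St_level X E) n (Fix {y \<in> X. n < height X E y})"
proof (induction n)
  case 0
  have "{y \<in> X. 0 < height X E y} = X - level X E 0" by (auto simp: level_def)
  then show ?case using subgroup_Fix[of "X - level X E 0"] by (simp add: St_level_eq_Fix)
next
  case (Suc n)
  let ?U = "\<lambda>n. {y \<in> X. n < height X E y}"
  have K: "subgroup (Fix (?U (Suc n))) A" and H: "subgroup (Fix (?U n)) A"
    by (auto intro!: subgroup_Fix)
  have HK: "Fix (?U n) \<subseteq> Fix (?U (Suc n))"
    and NK: "Fix (X - level X E (Suc n)) \<subseteq> Fix (?U (Suc n))"
    by (auto intro!: Fix_antimono simp: level_def)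
  have "Fix (X - level X E (Suc n)) \<lhd> A\<lparr>carrier := Fix (?U (Suc n))\<rparr>"
  proof (rule normal_Fix)
    \<comment> \<open>Only vertices of height at most \<open>n\<close> remain to be checked, and
      their admissible sets contain no higher vertex.\<close>
    fix y assume "y \<in> X - level X E (Suc n) - ?U (Suc n)"
    then have "y \<in> X" "height X E y \<le> n" by (auto simp: level_def)
    then show "adm X E y \<subseteq> X - level X E (Suc n)"
      using height_adm_le[of y] adm_subset by (fastforce simp: level_def)
  qed (auto simp: level_def)
  moreover have "Fix (?U n) <#>\<^bsub>A\<^esub> Fix (X - level X E (Suc n)) = Fix (?U (Suc n))"
  proof
    show "Fix (?U n) <#>\<^bsub>A\<^esub> Fix (X - level X E (Suc n)) \<subseteq> Fix (?U (Suc n))"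
      using HK NK subgroup.m_closed[OF K] by (auto simp: set_mult_def)
    show "Fix (?U (Suc n)) \<subseteq> Fix (?U n) <#>\<^bsub>A\<^esub> Fix (X - level X E (Suc n))"
    proof
      fix \<phi> assume \<phi>: "\<phi> \<in> Fix (?U (Suc n))"
      \<comment> \<open>The low vertices contain their own admissible sets, so
        \<open>Fix_split\<close> applies. The factor \<open>\<psi>\<close> moves only low generators
        and \<open>\<chi>\<close> only those of height \<open>Suc n\<close>.\<close>
      let ?S = "{y \<in> X. height X E y \<le> n}"
      have "adm X E x \<subseteq> ?S \<union> ?U (Suc n)" if "x \<in> ?S" for x
        using that height_adm_le[of x] adm_subset by fastforce
      then obtain \<psi> \<chi> where \<psi>: "\<psi> \<in> Fix (?U (Suc n) \<union> (X - ?S))"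
        and \<chi>: "\<chi> \<in> Fix (?U (Suc n) \<union> ?S)" and eq: "\<phi> = \<psi> \<otimes>\<^bsub>A\<^esub> \<chi>"
        using Fix_split[of ?S "?U (Suc n)" \<phi>] \<phi> by blast
      have "?U n \<subseteq> ?U (Suc n) \<union> (X - ?S)"
        "X - level X E (Suc n) \<subseteq> ?U (Suc n) \<union> ?S"
        by (auto simp: level_def)
      then show "\<phi> \<in> Fix (?U n) <#>\<^bsub>A\<^esub> Fix (X - level X E (Suc n))"
        using \<psi> \<chi> eq Fix_antimono unfolding set_mult_def by blast
    qed
  qed
  moreover have "Fix (?U n) \<inter> Fix (X - level X E (Suc n)) = {\<one>\<^bsub>A\<^esub>}"
  proof -
    have "?U n \<union> (X - level X E (Suc n)) = X" by (auto simp: level_def)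
    then show ?thesis by (simp add: Fix_Int Fix_all)
  qed
  ultimately have "internal_semidirect A (Fix (?U (Suc n))) (Fix (?U n)) (St_level X E (Suc n))"
    using A.subgroup_incl[OF H K HK] K by (simp add: internal_semidirect_def St_level_eq_Fix)
  then show ?case using Suc by auto
qed

lemma height_le_max_height: "x \<in> X \<Longrightarrow> height X E x \<le> max_height X E"
  unfolding max_height_def using finite_X by simp

text \<open>An element of \<open>adm X E x\<close> equivalent to \<open>y\<close> would have the
  height of \<open>x\<close>, hence be equivalent to \<open>x\<close> by \<open>height_adm\<close>,
  making \<open>x\<close> and \<open>y\<close> equivalent.\<close>

lemma adm_disjoint_class:
  assumes "x \<in> level X E k" "y \<in> level X E k" "(x, y) \<notin> sim X E"
  shows "adm X E x \<subseteq> X - sim X E `` {y}"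
proof
  fix z assume z: "z \<in> adm X E x"
  have "\<not> (y, z) \<in> sim X E"
  proof
    assume yz: "(y, z) \<in> sim X E"
    then have "height X E z = k" using assms height_sim[of y z] by (simp add: level_def)
    then have "(x, z) \<in> sim X E" using height_adm[of x z] z assms by (auto simp: level_def)
    with yz assms(3) show False by (simp add: sim_iff)
  qed
  then show "z \<in> X - sim X E `` {y}" using z adm_subset by blast
qed

lemma transversalE:
  assumes "transversal X E C" "x \<in> X"
  obtains c where "c \<in> C" "(c, x) \<in> sim X E"
proof -
  have "sim X E `` {x} \<in> X // sim X E" using assms(2) by (rule quotientI)
  then obtain c where "c \<in> sim X E `` {x} \<inter> C" using assms(1) by (auto simp: transversal_def)
  then show ?thesis using that[of c] by (simp add: sim_iff)
qed

lemma transversal_unique: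
  assumes C: "transversal X E C" and c: "c \<in> C" "d \<in> C" "(c, d) \<in> sim X E"
  shows "c = d"
proof -
  have "c \<in> X" using c by (simp add: sim_iff)
  then have "sim X E `` {c} \<in> X // sim X E" by (rule quotientI)
  then have "\<exists>!e. e \<in> sim X E `` {c} \<inter> C"
    by (rule bspec[OF conjunct2[OF C[unfolded transversal_def]]])
  moreover have "c \<in> sim X E `` {c} \<inter> C" "d \<in> sim X E `` {c} \<inter> C"
    using c \<open>c \<in> X\<close> by (auto simp: sim_iff)
  ultimately show ?thesis by blast
qed

text \<open>Induction on \<open>F\<close> splits off one class at a time: \<open>\<psi>\<close>
  moves only the class of the new vertex, and \<open>\<chi>\<close> fixes that class and falls under
  the induction hypothesis.\<close>

lemma Fix_classes_generate:
  assumes "finite F" "F \<subseteq> level X E k"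
  shows "Fix (X - (\<Union>c\<in>F. sim X E `` {c})) \<subseteq> generate A (\<Union>c\<in>F. St_class X E c)"
  using assms
proof (induction F rule: finite_induct)
  case empty
  then show ?case by (simp add: Fix_all generate.one)
next
  case (insert c F)
  show ?case
  proof
    let ?B = "X - (\<Union>c\<in>insert c F. sim X E `` {c})" and ?S = "sim X E `` {c}"
    fix \<phi> assume \<phi>: "\<phi> \<in> Fix ?B"
    have S: "?S \<subseteq> X" by (auto simp: sim_iff)
    have c: "c \<in> level X E k" using insert by simp
    have "adm X E x \<subseteq> ?S \<union> ?B" if x: "x \<in> ?S" for x
    proof
      fix z assume z: "z \<in> adm X E x"
      have xk: "x \<in> level X E k"
        using x c sim_class_subset_level[of c k] by (auto simp: level_def)
      \<comment> \<open>Elements of \<open>F\<close> may be equivalent to \<open>c\<close>. If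
        \<open>z\<close> lies in the class of some \<open>d\<close> in \<open>F\<close>, then
        \<open>adm_disjoint_class\<close> forces that class to be the class of
        \<open>c\<close>.\<close>
      have "z \<in> ?S" if "d \<in> F" "(d, z) \<in> sim X E" for d
      proof -
        have "d \<in> level X E k" using insert.prems that(1) by blast
        then have "(x, d) \<in> sim X E" using adm_disjoint_class[OF xk] z that(2) by blast
        then show ?thesis using x that(2) by (simp add: sim_iff)
      qed
      then show "z \<in> ?S \<union> ?B" using z adm_subset by blast
    qed
    then obtain \<psi> \<chi> where \<psi>: "\<psi> \<in> Fix (?B \<union> (X - ?S))"
      and \<chi>: "\<chi> \<in> Fix (?B \<union> ?S)" and eq: "\<phi> = \<psi> \<otimes>\<^bsub>A\<^esub> \<chi>"
      using Fix_split[OF S, of ?B \<phi>] \<phi> by blast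
    have "\<psi> \<in> Fix (X - ?S)" using \<psi> Fix_antimono[of "X - ?S" "?B \<union> (X - ?S)"] by blast
    then have "\<psi> \<in> St_class X E c" by (simp add: St_class_eq_Fix)
    then have "\<psi> \<in> generate A (\<Union>c\<in>insert c F. St_class X E c)"
      by (auto intro: generate.incl)
    moreover have "X - (\<Union>c\<in>F. sim X E `` {c}) \<subseteq> ?B \<union> ?S" by auto
    then have "\<chi> \<in> generate A (\<Union>c\<in>F. St_class X E c)"
      using \<chi> insert.IH insert.prems Fix_antimono by blast
    then have "\<chi> \<in> generate A (\<Union>c\<in>insert c F. St_class X E c)"
      using A.mono_generate[of "\<Union>c\<in>F. St_class X E c" "\<Union>c\<in>insert c F. St_class X E c"] by blast
    ultimately show "\<phi> \<in> generate A (\<Union>c\<in>insert c F. St_class X E c)"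
      unfolding eq by (rule generate.eng)
  qed
qed

text \<open>Within a level, an admissible set avoids every class other than that of its vertex,
  which gives normality of each factor and the generation. Intersections are trivial because the
  remaining factors all fix the class that the given factor may move.\<close>

lemma internal_direct_product_St_level:
  assumes C: "transversal X E C"
  shows "internal_direct_product A (level X E k \<inter> C) (St_class X E) (St_level X E k)"
  unfolding internal_direct_product_def
proof (intro conjI ballI)
  let ?I = "level X E k \<inter> C"
  have K: "subgroup (Fix (X - level X E k)) A" by (rule subgroup_Fix) blast
  then show "subgroup (St_level X E k) A" by (simp add: St_level_eq_Fix)
  have cls: "sim X E `` {y} \<subseteq> level X E k" if "y \<in> ?I" for y
    using that sim_class_subset_level by (auto simp: level_def)
  show "St_class X E y \<lhd> A\<lparr>carrier := St_level X E k\<rparr>" if y: "y \<in> ?I" for y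
    unfolding St_class_eq_Fix St_level_eq_Fix
  proof (rule normal_Fix)
    show "X - level X E k \<subseteq> X - sim X E `` {y}" using cls[OF y] by blast
    fix x assume "x \<in> X - sim X E `` {y} - (X - level X E k)"
    then have "x \<in> level X E k" "(x, y) \<notin> sim X E" by (auto simp: sim_iff)
    then show "adm X E x \<subseteq> X - sim X E `` {y}" using adm_disjoint_class y by blast
  qed blast
  show "generate A (\<Union>y\<in>?I. St_class X E y) = St_level X E k"
  proof
    show "generate A (\<Union>y\<in>?I. St_class X E y) \<subseteq> St_level X E k"
    proof (rule A.generate_subgroup_incl)
      show "(\<Union>y\<in>?I. St_class X E y) \<subseteq> St_level X E k"
        unfolding St_class_eq_Fix St_level_eq_Fix using cls by (intro UN_least Fix_antimono) blast
    qed (simp add: K St_level_eq_Fix)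
    have "level X E k \<subseteq> (\<Union>c\<in>?I. sim X E `` {c})"
    proof
      fix x assume x: "x \<in> level X E k"
      then obtain c where c: "c \<in> C" "(c, x) \<in> sim X E"
        using transversalE[OF C] by (auto simp: level_def)
      then have "c \<in> level X E k" using x height_sim[of c x] by (simp add: level_def sim_iff)
      with c show "x \<in> (\<Union>c\<in>?I. sim X E `` {c})" by blast
    qed
    then have "Fix (X - level X E k) \<subseteq> Fix (X - (\<Union>c\<in>?I. sim X E `` {c}))"
      by (intro Fix_antimono) blast
    moreover have "finite ?I" using finite_X by (simp add: level_def)
    ultimately show "St_level X E k \<subseteq> generate A (\<Union>y\<in>?I. St_class X E y)"
      using Fix_classes_generate[of ?I k] by (auto simp: St_level_eq_Fix)
  qed
  fix y assume y: "y \<in> ?I"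
  let ?D = "sim X E `` {y}" and ?R = "generate A (\<Union>j\<in>?I - {y}. St_class X E j)"
  have D: "?D \<subseteq> X" by (auto simp: sim_iff)
  have "?R \<subseteq> Fix ?D"
  proof (rule A.generate_subgroup_incl[OF _ subgroup_Fix[OF D]])
    \<comment> \<open>Distinct members of the transversal have disjoint classes, so every other
      factor fixes \<open>?D\<close> pointwise on generators.\<close>
    have "?D \<subseteq> X - sim X E `` {j}" if j: "j \<in> ?I - {y}" for j
    proof -
      have "(y, j) \<notin> sim X E" using transversal_unique[OF C] y j by blast
      then show ?thesis by (auto simp: sim_iff)
    qed
    then show "(\<Union>j\<in>?I - {y}. St_class X E j) \<subseteq> Fix ?D"
      unfolding St_class_eq_Fix by (intro UN_least Fix_antimono)
  qed
  then have "St_class X E y \<inter> ?R \<subseteq> Fix (X - ?D) \<inter> Fix ?D"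
    by (auto simp: St_class_eq_Fix)
  also have "\<dots> = {\<one>\<^bsub>A\<^esub>}"
    using D by (simp add: Fix_Int Fix_all Un_absorb2)
  finally show "St_class X E y \<inter> ?R = {\<one>\<^bsub>A\<^esub>}"
    using subgroup.one_closed[OF subgroup_Fix[of "X - ?D"]] generate.one[of A]
    by (auto simp: St_class_eq_Fix)
qed

end

theorem theorem1p1:
  fixes X C :: "'v set" and E :: "'v set set"
  assumes "finite_simple_graph X E" and "transversal X E C"
  shows "iterated_semidirect (Aut_raag X E) (St_level X E) (max_height X E) (StK X E) \<and>
    (\<forall>k \<le> max_height X E.
      internal_direct_product (Aut_raag X E) (level X E k \<inter> C) (St_class X E) (St_level X E k))"
proof -
  interpret raag_graph X E by (rule raag_graph.intro[OF assms(1)])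
  \<comment> \<open>At the maximal height nothing is left to fix, and \<open>Fix {}\<close> is the
    whole stabiliser.\<close>
  have "{y \<in> X. max_height X E < height X E y} = {}"
    using height_le_max_height by (auto simp: not_less)
  then have "iterated_semidirect A (St_level X E) (max_height X E) (StK X E)"
    using iterated_semidirect_Fix[of "max_height X E"] by (simp only: StK_eq_Fix)
  then show ?thesis using internal_direct_product_St_level[OF assms(2)] by blast
qed

end
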